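(* Let $f:\mathbb{R}^d\to\mathbb{R}$, $f(w)=\mathbb{E}_\xi[F(w,\xi)]$, be $L$-smooth with stochastic gradients that are unbiased and have variance at most $\sigma^2$, let $g:\mathbb{R}^d\to\mathbb{R}$ be Lipschitz continuous with parameter $l$ and such that $\operatorname{prox}_{\lambda g}(w)\neq\emptyset$ for all $w\in\mathbb{R}^d$, $\lambda>0$, let $h=f+g$ have a global minimizer $w^*$, let $w^1\in\mathbb{R}^d$, and put $\Delta=2(h(w^1)-h(w^* ))$. Run algorithm MBSGA (defined in the context) with $\alpha=\theta=0.25$ from $w^1$. Then an $\epsilon$-stationary solution is obtained with gradient call complexity $O(\epsilon^{-5})$ and proximal operator complexity $O(\epsilon^{-4})$. That is, there is a constant $C$ depending only on $L,l,\sigma,\Delta$ such that for every $\epsilon\in(0,1]$ there is $N\in\mathbb{Z}_{>0}$ for which the output $\bar w^R$ of MBSGA with inputs $w^1,N,\alpha=\theta=0.25$ satisfies $$\mathbb{E}\left[\operatorname{dist}(0,\partial h(\bar w^R))\right]\le\epsilon,$$ while the algorithm uses at most $C\epsilon^{-5}$ gradient calls and at most $C\epsilon^{-4}$ proximal operations.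
   Context: A function $f$ is $L$-smooth if it is differentiable and $\|\nabla f(w)-\nabla f(x)\|_2\le L\|w-x\|_2$ for all $w,x$. Stochastic gradients: $\xi\in\mathbb{R}^p$ has distribution $P$; for every $w$, $\mathbb{E}[\nabla F(w,\xi)]=\nabla f(w)$ and $\mathbb{E}\|\nabla F(w,\xi)-\nabla f(w)\|_2^2\le\sigma^2$, with $\sigma>0$ a constant. Subdifferential: $\hat\partial h(w)=\{v:\liminf_{x\to w,x\ne w}\frac{h(x)-h(w)-\langle v,x-w\rangle}{\|x-w\|_2}\ge0\}$, and the limiting subdifferential is $\partial h(w)=\{v:\exists\, w^k\to w,\ h(w^k)\to h(w),\ v^k\in\hat\partial h(w^k),\ v^k\to v\}$. Proximal operator: $\operatorname{prox}_{\lambda g}(w)=\operatorname{argmin}_{x\in\mathbb{R}^d}\{\frac1{2\lambda}\|w-x\|_2^2+g(x)\}$. A (measurable) selection $\zeta^\lambda(w)\in\operatorname{prox}_{\lambda g}(w)$ is fixed. Algorithm MBSGA. Input: $w^1\in\mathbb{R}^d$, $N\in\mathbb{Z}_{>0}$, $\alpha,\theta\in\mathbb{R}$. Set $M=\lceil N^\alpha\rceil$, $\lambda=N^{-\theta}$, $L_{E\lambda}=L+\frac1\lambda$, $\gamma=\min\{\frac1{L_{E\lambda}},\frac1{\sigma\sqrt N}\}$. Draw $R$ uniformly from $\{1,\dots,N\}$, independently of all other samples. For $k=1,\dots,R-1$: draw fresh i.i.d. samples $\xi^k_1,\dots,\xi^k_M\sim P$ (independent of the past) and set $$w^{k+1}=w^k-\gamma\Big(\frac1M\sum_{j=1}^M\nabla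 F(w^k,\xi^k_j)+\frac1\lambda\big(w^k-\zeta^\lambda(w^k)\big)\Big).$$ Output: $\bar w^R=\zeta^\lambda(w^R)\in\operatorname{prox}_{\lambda g}(w^R)$. A gradient call is one evaluation of $\nabla F(w,\xi)$ at a given $w$ and sample $\xi$; a proximal operation is one evaluation of $\zeta^\lambda$. An $\epsilon$-stationary solution is a (random) $\bar w$ with $\mathbb{E}[\operatorname{dist}(0,\partial h(\bar w))]\le\epsilon$. *)

theory Defs
  imports "HOL-Probability.Probability"
begin

definition grad :: "('a::real_inner \<Rightarrow> real) \<Rightarrow> 'a \<Rightarrow> 'a" where
  "grad f x = (THE D. GDERIV f x :> D)"

definition smooth_with :: "real \<Rightarrow> ('a::real_inner \<Rightarrow> real) \<Rightarrow> bool" where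
  "smooth_with L f \<longleftrightarrow>
     (\<forall>x. f differentiable (at x)) \<and>
     (\<forall>w x. norm (grad f w - grad f x) \<le> L * norm (w - x))"

definition frechet_subdiff :: "('a::real_inner \<Rightarrow> real) \<Rightarrow> 'a \<Rightarrow> 'a set" where
  "frechet_subdiff h w =
     {v. 0 \<le> Liminf (at w) (\<lambda>x. ereal ((h x - h w - v \<bullet> (x - w)) / norm (x - w)))}"

definition limiting_subdiff :: "('a::real_inner \<Rightarrow> real) \<Rightarrow> 'a \<Rightarrow> 'a set" where
  "limiting_subdiff h w =
     {v. \<exists>W V. W \<longlonglongrightarrow> w \<and> (\<lambda>k. h (W k)) \<longlonglongrightarrow> h w \<and>
               (\<forall>k. V k \<in> frechet_subdiff h (W k)) \<and> V \<longlonglongrightarrow> v}"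

(* Extended-valued on purpose: the distance to the empty set is infinite here, whereas
   infdist x {} = 0 would make a point with empty subdifferential look stationary. *)
definition edist :: "'a::metric_space \<Rightarrow> 'a set \<Rightarrow> ennreal" where
  "edist x A = (INF y\<in>A. ennreal (dist x y))"

definition prox :: "real \<Rightarrow> ('a::real_inner \<Rightarrow> real) \<Rightarrow> 'a \<Rightarrow> 'a set" where
  "prox lam g w =
     {x. is_arg_min (\<lambda>y. 1 / (2 * lam) * (norm (w - y))\<^sup>2 + g y) (\<lambda>_. True) x}"

definition batch_size :: "nat \<Rightarrow> real \<Rightarrow> nat" where
  "batch_size N \<alpha> = nat \<lceil>real N powr \<alpha>\<rceil>"

definition prox_param :: "nat \<Rightarrow> real \<Rightarrow> real" where
  "prox_param N \<theta> = real N powr (- \<theta>)"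

definition step_size :: "real \<Rightarrow> real \<Rightarrow> nat \<Rightarrow> real \<Rightarrow> real" where
  "step_size L \<sigma> N \<theta> =
     min (1 / (L + 1 / prox_param N \<theta>)) (1 / (\<sigma> * sqrt (real N)))"

record 'a mbsga_state =
  iterate :: 'a
  gradient_calls :: nat
  prox_calls :: nat

(* The state after n iterations holds w^(n+1) and the number of oracle evaluations so far.
   G is the stochastic gradient, z the proximal selection for the parameter lam, and
   xi k j is the j-th sample of iteration k. An iteration evaluates G at M samples and
   z once. *)
primrec mbsga_loop ::
  "('a::real_inner \<Rightarrow> 'b \<Rightarrow> 'a) \<Rightarrow> ('a \<Rightarrow> 'a) \<Rightarrow> nat \<Rightarrow> real \<Rightarrow> real \<Rightarrow> 'a \<Rightarrow>
   (nat \<Rightarrow> nat \<Rightarrow> 'b) \<Rightarrow> nat \<Rightarrow> 'a mbsga_state" where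
  "mbsga_loop G z M lam \<gamma> w1 xi 0 =
     \<lparr>iterate = w1, gradient_calls = 0, prox_calls = 0\<rparr>"
| "mbsga_loop G z M lam \<gamma> w1 xi (Suc n) =
     (let s = mbsga_loop G z M lam \<gamma> w1 xi n; w = iterate s in
      \<lparr>iterate = w - \<gamma> *\<^sub>R ((1 / real M) *\<^sub>R (\<Sum>j = 1..M. G w (xi (Suc n) j))
                        + (1 / lam) *\<^sub>R (w - z w)),
       gradient_calls = gradient_calls s + M,
       prox_calls = prox_calls s + 1\<rparr>)"

(* A run is a function of the random inputs (R, xi); the final state holds the output
   z(w^R), whose computation costs one more proximal operation. *)
definition mbsga ::
  "real \<Rightarrow> real \<Rightarrow> ('a::real_inner \<Rightarrow> 'b \<Rightarrow> 'a) \<Rightarrow> (real \<Rightarrow> 'a \<Rightarrow> 'a) \<Rightarrow> 'a \<Rightarrow> nat \<Rightarrow> real \<Rightarrow> real \<Rightarrow>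
   nat \<times> (nat \<Rightarrow> nat \<Rightarrow> 'b) \<Rightarrow> 'a mbsga_state" where
  "mbsga L \<sigma> G \<zeta> w1 N \<alpha> \<theta> = (\<lambda>(R, xi).
     let lam = prox_param N \<theta>;
         s = mbsga_loop G (\<zeta> lam) (batch_size N \<alpha>) lam (step_size L \<sigma> N \<theta>) w1 xi (R - 1)
     in \<lparr>iterate = \<zeta> lam (iterate s),
         gradient_calls = gradient_calls s,
         prox_calls = prox_calls s + 1\<rparr>)"

(* R is uniform on {1..N}, the samples xi k j are i.i.d. with law P, and R is independent
   of the samples; a run uses those of the iterations k < R. *)
definition mbsga_inputs ::
  "'b measure \<Rightarrow> nat \<Rightarrow> real \<Rightarrow> (nat \<times> (nat \<Rightarrow> nat \<Rightarrow> 'b)) measure" where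
  "mbsga_inputs P N \<alpha> =
     uniform_count_measure {1..N} \<Otimes>\<^sub>M
     (\<Pi>\<^sub>M k\<in>{1..<N}. \<Pi>\<^sub>M j\<in>{1..batch_size N \<alpha>}. P)"

(* An explicit constant instead of an existential one: a constant existentially quantified
   in a theorem could depend on the types that carry the dimensions of the decision space
   and of the sample space. The square root of the expression in L, l, \<sigma>, \<Delta>, times
   N powr (-1/4), bounds the expected norm of the gradient that drives the iteration, and
   2 * L * l times N powr (-1/4) bounds the change of grad f from w to the proximal point. *)
definition mbsga_const :: "real \<Rightarrow> real \<Rightarrow> real \<Rightarrow> real \<Rightarrow> real" where
  "mbsga_const L l \<sigma> \<Delta> =
     2 * (1 + 2 * L * l + sqrt ((\<Delta> + l\<^sup>2) * (L + \<sigma> + 1) + \<sigma> * (L + 1))) ^ 5"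

end

theory Submission
  imports Defs
begin

text \<open>The iteration is stochastic gradient descent on \<open>f\<close> plus the Moreau envelope of \<open>g\<close>, where the
  proximal point of the current iterate yields a smooth majorant whose gradient drives the step.
  In expectation each step decreases this potential by a multiple of the squared norm of the drift,
  up to a noise term of order \<open>\<sigma>\<^sup>2 / M\<close>. Telescoping bounds the mean squared drift at a
  uniformly chosen iterate \<open>w\<close>. The optimality condition at its proximal point \<open>z\<close> exhibits
  \<open>grad f z + (w - z) / \<lambda>\<close> as a subgradient of \<open>f + g\<close> there; it differs from
  the drift by at most \<open>L * norm (w - z) \<le> 2 * L * l * \<lambda>\<close>.\<close>

section \<open>Smooth functions and proximal points\<close>

text \<open>\<open>grad\<close> is a definite description, so the derivative must have exactly one
  representing vector. Its coordinates are the values of the derivative on \<open>Basis\<close>;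
  inner products with all vectors determine it.\<close>

lemma has_gderiv_grad:
  fixes f :: "'a::euclidean_space \<Rightarrow> real"
  assumes "f differentiable (at x)"
  shows "GDERIV f x :> grad f x"
proof -
  obtain D where D: "(f has_derivative D) (at x)"
    using assms by (auto simp: differentiable_def)
  interpret bounded_linear D using D by (rule has_derivative_bounded_linear)
  let ?v = "\<Sum>b\<in>Basis. D b *\<^sub>R b"
  have "D y = y \<bullet> ?v" for y
  proof -
    have "D y = D (\<Sum>b\<in>Basis. (y \<bullet> b) *\<^sub>R b)" by (simp add: euclidean_representation)
    also have "\<dots> = (\<Sum>b\<in>Basis. (y \<bullet> b) * D b)" by (simp add: sum scaleR)
    also have "\<dots> = y \<bullet> ?v" by (simp add: inner_sum_right mult.commute)
    finally show ?thesis .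
  qed
  then have v: "GDERIV f x :> ?v"
    using D unfolding gderiv_def by (metis (no_types, lifting) ext)
  have "E = ?v" if "GDERIV f x :> E" for E
  proof -
    have "(\<lambda>h. h \<bullet> E) = (\<lambda>h. h \<bullet> ?v)"
      using that v unfolding gderiv_def by (rule has_derivative_unique)
    then have "x \<bullet> E = x \<bullet> ?v" for x by (rule fun_cong)
    then show ?thesis by (subst vector_eq_ldot[symmetric]) blast
  qed
  then have "grad f x = ?v" unfolding grad_def using v by (intro the_equality)
  with v show ?thesis by simp
qed

text \<open>The descent lemma. Along the segment from \<open>x\<close> to \<open>y\<close> the gap
  between \<open>f\<close> and its quadratic model, up to a constant, has nonpositive derivative by
  Cauchy-Schwarz and the Lipschitz bound.\<close>

lemma gderiv_lipschitz_upper: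
  fixes f :: "'a::real_inner \<Rightarrow> real"
  assumes D: "\<And>x. GDERIV f x :> D x"
    and lip: "\<And>w x. norm (D w - D x) \<le> L * norm (w - x)"
  shows "f y \<le> f x + D x \<bullet> (y - x) + L / 2 * (norm (y - x))\<^sup>2"
proof -
  define d where "d = y - x"
  define \<phi> where "\<phi> t = f (x + t *\<^sub>R d) - t * (D x \<bullet> d) - L / 2 * t\<^sup>2 * (norm d)\<^sup>2" for t
  have "(\<phi> has_real_derivative (D (x + t *\<^sub>R d) \<bullet> d - D x \<bullet> d - L * t * (norm d)\<^sup>2)) (at t)" for t
  proof -
    have "((\<lambda>t. x + t *\<^sub>R d) has_derivative (\<lambda>h. h *\<^sub>R d)) (at t)"
      by (auto intro!: derivative_eq_intros)
    from has_derivative_compose[OF this D[unfolded gderiv_def]]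
    have "((\<lambda>t. f (x + t *\<^sub>R d)) has_real_derivative (D (x + t *\<^sub>R d) \<bullet> d)) (at t)"
      unfolding has_field_derivative_def by (simp add: inner_commute mult.commute[of _ "_ \<bullet> _"])
    note [derivative_intros] = this
    show ?thesis unfolding \<phi>_def
      by (auto intro!: derivative_eq_intros simp: power2_eq_square)
  qed
  moreover have "D (x + t *\<^sub>R d) \<bullet> d - D x \<bullet> d - L * t * (norm d)\<^sup>2 \<le> 0" if "0 \<le> t" for t
  proof -
    have "D (x + t *\<^sub>R d) \<bullet> d - D x \<bullet> d = (D (x + t *\<^sub>R d) - D x) \<bullet> d"
      by (simp add: inner_diff_left)
    also have "\<dots> \<le> norm (D (x + t *\<^sub>R d) - D x) * norm d"
      by (rule norm_cauchy_schwarz)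
    also have "\<dots> \<le> (L * norm (t *\<^sub>R d)) * norm d"
      using lip[of "x + t *\<^sub>R d" x] by (intro mult_right_mono) auto
    finally show ?thesis using that by (simp add: power2_eq_square algebra_simps)
  qed
  ultimately have "\<phi> 1 \<le> \<phi> 0"
    by (intro DERIV_nonpos_imp_nonincreasing[of 0 1 \<phi>]) (simp, blast)
  then show ?thesis by (simp add: \<phi>_def d_def)
qed

lemma smooth_with_gderiv:
  fixes f :: "'a::euclidean_space \<Rightarrow> real"
  assumes "smooth_with L f"
  shows "GDERIV f x :> grad f x"
  using assms by (simp add: smooth_with_def has_gderiv_grad)

lemma smooth_with_upper:
  fixes f :: "'a::euclidean_space \<Rightarrow> real"
  assumes "smooth_with L f"
  shows "f y \<le> f x + grad f x \<bullet> (y - x) + L / 2 * (norm (y - x))\<^sup>2"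
  using smooth_with_gderiv[OF assms] assms
  by (intro gderiv_lipschitz_upper) (auto simp: smooth_with_def)

lemma smooth_with_lower:
  fixes f :: "'a::euclidean_space \<Rightarrow> real"
  assumes "smooth_with L f"
  shows "f x + grad f x \<bullet> (y - x) - L / 2 * (norm (y - x))\<^sup>2 \<le> f y"
proof -
  have "- f y \<le> - f x + (- grad f x) \<bullet> (y - x) + L / 2 * (norm (y - x))\<^sup>2"
    using smooth_with_gderiv[OF assms] assms
    by (intro gderiv_lipschitz_upper[of "\<lambda>x. - f x" "\<lambda>x. - grad f x"] GDERIV_minus)
      (auto simp: smooth_with_def norm_minus_commute)
  then show ?thesis by simp
qed

lemma smooth_with_nonneg:
  fixes f :: "'a::euclidean_space \<Rightarrow> real"
  assumes "smooth_with L f"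
  shows "0 \<le> L"
proof -
  \<comment> \<open>A unit vector gives two points at distance one; a Euclidean space has at least
    one.\<close>
  obtain b :: 'a where "b \<in> Basis" using nonempty_Basis by blast
  then have "norm (grad f b - grad f 0) \<le> L"
    using assms unfolding smooth_with_def by (metis diff_zero mult.right_neutral norm_Basis)
  then show ?thesis using norm_ge_zero order_trans by blast
qed

lemma smooth_with_continuous_grad:
  fixes f :: "'a::euclidean_space \<Rightarrow> real"
  assumes "smooth_with L f"
  shows "continuous_on UNIV (grad f)"
proof -
  have "L-lipschitz_on UNIV (grad f)"
    using assms smooth_with_nonneg[OF assms]
    by (intro lipschitz_onI) (auto simp: smooth_with_def dist_norm)
  then show ?thesis by (rule lipschitz_on_continuous_on)
qed

lemma smooth_with_continuous:
  fixes f :: "'a::euclidean_space \<Rightarrow> real"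
  assumes "smooth_with L f"
  shows "continuous_on UNIV f"
  using assms
  by (auto simp: smooth_with_def continuous_on_eq_continuous_at differentiable_imp_continuous_within)

section \<open>Proximal points and subgradients\<close>

lemma prox_le:
  assumes "z \<in> prox lam g w"
  shows "1 / (2 * lam) * (norm (w - z))\<^sup>2 + g z \<le> 1 / (2 * lam) * (norm (w - x))\<^sup>2 + g x"
  using assms by (force simp: prox_def is_arg_min_def not_less)

text \<open>The point \<open>w\<close> itself competes in the minimization, so the quadratic term is
  at most the decrease of \<open>g\<close>, which is linear in the distance. Cancelling one factor
  of the distance requires it to be nonzero.\<close>

lemma prox_norm_le:
  assumes "z \<in> prox lam g w" "lam > 0" "l-lipschitz_on UNIV g"
  shows "norm (w - z) \<le> 2 * l * lam"
proof (cases "norm (w - z) = 0")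
  case True
  then show ?thesis using assms(2) lipschitz_on_nonneg[OF assms(3)] by simp
next
  case False
  have "g w - g z \<le> l * norm (w - z)"
    using lipschitz_onD[OF assms(3), of w z] by (simp add: dist_norm)
  then have "1 / (2 * lam) * (norm (w - z))\<^sup>2 \<le> l * norm (w - z)"
    using prox_le[OF assms(1), of w] by simp
  then have "(norm (w - z)) * norm (w - z) \<le> (2 * l * lam) * norm (w - z)"
    using assms(2) by (simp add: field_simps power2_eq_square)
  with False show ?thesis by (simp only: mult_le_cancel_right) auto
qed

lemma norm_sq_shift:
  fixes x w z :: "'a::real_inner"
  shows "(norm (x - z))\<^sup>2 = (norm (w - z))\<^sup>2 + 2 * ((w - z) \<bullet> (x - w)) + (norm (x - w))\<^sup>2"
  by (simp add: power2_norm_eq_inner algebra_simps inner_commute)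

text \<open>Minimality of \<open>z\<close> bounds \<open>g\<close> from below by a quadratic with
  slope \<open>(w - z) / lam\<close> at \<open>z\<close>, and smoothness does the same for
  \<open>f\<close> with slope \<open>grad f z\<close>. The error is quadratic, so it vanishes in the
  difference quotient.\<close>

lemma prox_frechet_subdiff:
  fixes f g :: "'a::euclidean_space \<Rightarrow> real"
  assumes "z \<in> prox lam g w" "lam > 0" and f: "smooth_with L f"
  shows "grad f z + (1 / lam) *\<^sub>R (w - z) \<in> frechet_subdiff (\<lambda>x. f x + g x) z"
proof -
  let ?v = "grad f z + (1 / lam) *\<^sub>R (w - z)"
  \<comment> \<open>Half the sum of the curvatures: \<open>L\<close> from \<open>f\<close> and
    \<open>1 / lam\<close> from the proximal quadratic.\<close>
  define c where "c = (L + 1 / lam) / 2"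
  have quot: "- (c * norm (x - z)) \<le> (f x + g x - (f z + g z) - ?v \<bullet> (x - z)) / norm (x - z)"
    if "x \<noteq> z" for x
  proof -
    have "(norm (w - x))\<^sup>2 = (norm (w - z))\<^sup>2 - 2 * ((w - z) \<bullet> (x - z)) + (norm (x - z))\<^sup>2"
      by (simp add: power2_norm_eq_inner algebra_simps inner_commute)
    then have "1 / (2 * lam) * (norm (w - x))\<^sup>2 = 1 / (2 * lam) * (norm (w - z))\<^sup>2
        - (1 / lam) * ((w - z) \<bullet> (x - z)) + 1 / (2 * lam) * (norm (x - z))\<^sup>2"
      using assms(2) by (simp add: field_simps)
    then have "g z + (1 / lam) * ((w - z) \<bullet> (x - z)) - 1 / (2 * lam) * (norm (x - z))\<^sup>2 \<le> g x"
      using prox_le[OF assms(1), of x] by linarith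
    moreover have "f z + grad f z \<bullet> (x - z) - L / 2 * (norm (x - z))\<^sup>2 \<le> f x"
      by (rule smooth_with_lower[OF f])
    ultimately have "- (c * (norm (x - z))\<^sup>2) \<le> f x + g x - (f z + g z) - ?v \<bullet> (x - z)"
      by (simp add: c_def algebra_simps add_divide_distrib)
    then show ?thesis using that by (simp add: field_simps power2_eq_square)
  qed
  have "((\<lambda>x. ereal (- (c * norm (x - z)))) \<longlongrightarrow> ereal (- (c * norm (z - z)))) (at z)"
    by (intro tendsto_intros)
  then have "Liminf (at z) (\<lambda>x. ereal (- (c * norm (x - z)))) = 0"
    by (intro lim_imp_Liminf) (auto simp: zero_ereal_def)
  moreover have "Liminf (at z) (\<lambda>x. ereal (- (c * norm (x - z)))) \<le>
      Liminf (at z) (\<lambda>x. ereal ((f x + g x - (f z + g z) - ?v \<bullet> (x - z)) / norm (x - z)))"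
    using quot by (intro Liminf_mono) (auto simp: eventually_at_filter)
  ultimately show ?thesis by (simp add: frechet_subdiff_def)
qed

lemma frechet_subset_limiting_subdiff: "frechet_subdiff h w \<subseteq> limiting_subdiff h w"
proof
  fix v assume "v \<in> frechet_subdiff h w"
  then show "v \<in> limiting_subdiff h w"
    unfolding limiting_subdiff_def
    by (intro CollectI exI[of _ "\<lambda>_. w"] exI[of _ "\<lambda>_. v"]) auto
qed

lemma edist_le: "y \<in> A \<Longrightarrow> edist x A \<le> ennreal (dist x y)"
  unfolding edist_def by (rule INF_lower)

section \<open>Joint measurability of stochastic gradients\<close>

text \<open>Simple functions \<open>q n\<close> tend to the identity. On each of the finitely many
  values of \<open>q n\<close> only measurability in the sample matters, and continuity in
  \<open>w\<close> carries it to the limit.\<close>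

lemma borel_measurable_Caratheodory:
  fixes F :: "'a::{metric_space,second_countable_topology} \<Rightarrow> 'b \<Rightarrow> 'c::metric_space"
  assumes meas: "\<And>w. F w \<in> borel_measurable M"
    and cont: "\<And>\<xi>. continuous_on UNIV (\<lambda>w. F w \<xi>)"
  shows "case_prod F \<in> borel_measurable (borel \<Otimes>\<^sub>M M)"
proof -
  \<comment> \<open>The approximation theorem also bounds distances to a base point. Only the
    convergence matters here, so \<open>undefined\<close> serves as that point.\<close>
  obtain q :: "nat \<Rightarrow> 'a \<Rightarrow> 'a" where q: "\<And>n. simple_function borel (q n)"
    and lim: "\<And>w. (\<lambda>n. q n w) \<longlonglongrightarrow> w"
    using borel_measurable_implies_sequence_metric[of "\<lambda>x. x" borel undefined] by auto
  show ?thesis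
  proof (rule borel_measurable_LIMSEQ_metric)
    fix n
    have "(\<lambda>x. F (q n (fst x)) (snd x)) \<in> borel_measurable (borel \<Otimes>\<^sub>M M)"
    proof (rule measurable_compose_countable'[where f="\<lambda>a x. F a (snd x)" and I="range (q n)"])
      show "countable (range (q n))"
        using simple_functionD(1)[OF q, of n] by (simp add: countable_finite)
      show "(\<lambda>x. q n (fst x)) \<in> borel \<Otimes>\<^sub>M M \<rightarrow>\<^sub>M count_space (range (q n))"
        using measurable_compose[OF measurable_fst measurable_simple_function[OF q]]
        by (rule measurable_count_space_extend[OF _ _, rotated -1]) auto
    qed (use meas in measurable)
    then show "(\<lambda>x. F (q n (fst x)) (snd x)) \<in> borel_measurable (borel \<Otimes>\<^sub>M M)" .
  next
    fix x
    have "isCont (\<lambda>w. F w (snd x)) (fst x)"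
      using cont by (simp add: continuous_on_eq_continuous_at)
    then show "(\<lambda>n. F (q n (fst x)) (snd x)) \<longlonglongrightarrow> case_prod F x"
      using isCont_tendsto_compose lim by (fastforce simp: split_beta)
  qed
qed

text \<open>The algorithm evaluates gradients at random iterates, so measurability for fixed
  \<open>w\<close> does not suffice. Each component of the gradient is a limit of difference
  quotients of \<open>F\<close>, which is jointly measurable because differentiability makes it
  continuous in \<open>w\<close>.\<close>

lemma borel_measurable_grad:
  fixes F :: "'a::euclidean_space \<Rightarrow> 'b \<Rightarrow> real"
  assumes meas: "\<And>w. F w \<in> borel_measurable M"
    and diff: "\<And>w \<xi>. (\<lambda>v. F v \<xi>) differentiable (at w)"
  shows "(\<lambda>(w, \<xi>). grad (\<lambda>v. F v \<xi>) w) \<in> borel_measurable (borel \<Otimes>\<^sub>M M)"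
proof -
  have F: "case_prod F \<in> borel_measurable (borel \<Otimes>\<^sub>M M)"
    using meas diff
    by (intro borel_measurable_Caratheodory)
      (auto simp: continuous_on_eq_continuous_at differentiable_imp_continuous_within)
  have "(\<lambda>x. grad (\<lambda>v. F v (snd x)) (fst x) \<bullet> b) \<in> borel_measurable (borel \<Otimes>\<^sub>M M)" for b
  proof (rule borel_measurable_LIMSEQ_real)
    fix n :: nat
    let ?t = "inverse (real (Suc n))"
    have "(\<lambda>x. (fst x + ?t *\<^sub>R b, snd x)) \<in> borel \<Otimes>\<^sub>M M \<rightarrow>\<^sub>M borel \<Otimes>\<^sub>M M"
      by measurable
    from measurable_compose[OF this F]
    have "(\<lambda>x. F (fst x + ?t *\<^sub>R b) (snd x)) \<in> borel_measurable (borel \<Otimes>\<^sub>M M)" by simp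
    moreover have "(\<lambda>x. F (fst x) (snd x)) \<in> borel_measurable (borel \<Otimes>\<^sub>M M)"
      using F by (simp add: split_beta')
    ultimately show "(\<lambda>x. (F (fst x + ?t *\<^sub>R b) (snd x) - F (fst x) (snd x)) / ?t)
        \<in> borel_measurable (borel \<Otimes>\<^sub>M M)" by measurable
  next
    fix x :: "'a \<times> 'b"
    have "GDERIV (\<lambda>v. F v (snd x)) (fst x) :> grad (\<lambda>v. F v (snd x)) (fst x)"
      using diff by (rule has_gderiv_grad)
    \<comment> \<open>The point is written as the value of the path at 0, which is the form the
      chain rule asks for.\<close>
    then have D: "((\<lambda>v. F v (snd x)) has_derivative (\<lambda>h. h \<bullet> grad (\<lambda>v. F v (snd x)) (fst x)))
        (at (fst x + 0 *\<^sub>R b))" by (simp add: gderiv_def)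
    have "((\<lambda>t. fst x + t *\<^sub>R b) has_derivative (\<lambda>h. h *\<^sub>R b)) (at 0)"
      by (auto intro!: derivative_eq_intros)
    from has_derivative_compose[OF this D]
    have "((\<lambda>t. F (fst x + t *\<^sub>R b) (snd x)) has_real_derivative
        grad (\<lambda>v. F v (snd x)) (fst x) \<bullet> b) (at 0)"
      unfolding has_field_derivative_def by (simp add: inner_commute mult.commute[of _ "_ \<bullet> _"])
    then have "((\<lambda>t. (F (fst x + t *\<^sub>R b) (snd x) - F (fst x) (snd x)) / t) \<longlongrightarrow>
        grad (\<lambda>v. F v (snd x)) (fst x) \<bullet> b) (at 0)"
      by (simp add: DERIV_def)
    \<comment> \<open>The increments tend to 0 without reaching it, as the punctured neighbourhood
      filter demands.\<close>
    moreover have "filterlim (\<lambda>n. inverse (real (Suc n))) (at 0) sequentially"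
      using LIMSEQ_inverse_real_of_nat by (auto simp: filterlim_at)
    ultimately show "(\<lambda>n. (F (fst x + inverse (real (Suc n)) *\<^sub>R b) (snd x) - F (fst x) (snd x))
        / inverse (real (Suc n))) \<longlonglongrightarrow> grad (\<lambda>v. F v (snd x)) (fst x) \<bullet> b"
      by (rule filterlim_compose)
  qed
  then show ?thesis
    by (subst borel_measurable_euclidean_space) (simp add: split_beta')
qed

section \<open>Integrals over product spaces\<close>

text \<open>Independent centred vectors are orthogonal in the mean. The induction integrates out the
  new coordinate with the sum of the others held fixed, so that the mixed term vanishes and one
  variance is added.\<close>

lemma (in prob_space) nn_integral_PiM_norm_sum:
  fixes D :: "'a \<Rightarrow> 'b::euclidean_space"
  assumes D: "integrable M D" "(\<integral>y. D y \<partial>M) = 0" "integrable M (\<lambda>y. (norm (D y))\<^sup>2)"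
    and "finite J"
  shows "(\<integral>\<^sup>+y. ennreal ((norm (\<Sum>j\<in>J. D (y j)))\<^sup>2) \<partial>(\<Pi>\<^sub>M j\<in>J. M)) =
    ennreal (real (card J) * (\<integral>y. (norm (D y))\<^sup>2 \<partial>M))"
  using \<open>finite J\<close>
proof (induction J rule: finite_induct)
  case empty
  show ?case by simp
next
  case (insert i J)
  interpret P: product_prob_space "\<lambda>_. M" by standard
  let ?V = "\<integral>y. (norm (D y))\<^sup>2 \<partial>M"
  have [measurable]: "D \<in> borel_measurable M" using D(1) by simp
  have V: "0 \<le> ?V" by simp
  have inner: "(\<integral>\<^sup>+y. ennreal ((norm (s + D y))\<^sup>2) \<partial>M) = ennreal ((norm s)\<^sup>2) + ennreal ?V" for s
  proof -
    have eq: "(norm (s + D y))\<^sup>2 = (norm s)\<^sup>2 + 2 * (D y \<bullet> s) + (norm (D y))\<^sup>2" for y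
      by (simp add: power2_norm_eq_inner algebra_simps inner_commute)
    have int: "integrable M (\<lambda>y. (norm (s + D y))\<^sup>2)"
      unfolding eq using D by (intro Bochner_Integration.integrable_add integrable_mult_right integrable_inner_left) auto
    have "(\<integral>y. (norm (s + D y))\<^sup>2 \<partial>M) = (norm s)\<^sup>2 + 2 * ((\<integral>y. D y \<partial>M) \<bullet> s) + ?V"
      unfolding eq using D by (simp add: prob_space)
    with D have "(\<integral>y. (norm (s + D y))\<^sup>2 \<partial>M) = (norm s)\<^sup>2 + ?V" by simp
    then show ?thesis
      using nn_integral_eq_integral[OF int] V by simp
  qed
  have "(\<integral>\<^sup>+y. ennreal ((norm (\<Sum>j\<in>insert i J. D (y j)))\<^sup>2) \<partial>(\<Pi>\<^sub>M j\<in>insert i J. M)) =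
    (\<integral>\<^sup>+x. (\<integral>\<^sup>+y. ennreal ((norm (\<Sum>j\<in>insert i J. D ((x(i := y)) j)))\<^sup>2) \<partial>M) \<partial>(\<Pi>\<^sub>M j\<in>J. M))"
    using insert by (intro P.product_nn_integral_insert) auto
  also have "\<dots> = (\<integral>\<^sup>+x. (\<integral>\<^sup>+y. ennreal ((norm ((\<Sum>j\<in>J. D (x j)) + D y))\<^sup>2) \<partial>M) \<partial>(\<Pi>\<^sub>M j\<in>J. M))"
  proof -
    have "(\<Sum>j\<in>insert i J. D ((x(i := y)) j)) = (\<Sum>j\<in>J. D (x j)) + D y" for x y
    proof -
      have "(\<Sum>j\<in>J. D ((x(i := y)) j)) = (\<Sum>j\<in>J. D (x j))"
        using insert.hyps by (intro sum.cong) auto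
      then show ?thesis using insert.hyps by (simp add: add.commute)
    qed
    then show ?thesis by simp
  qed
  also have "\<dots> = (\<integral>\<^sup>+x. ennreal ((norm (\<Sum>j\<in>J. D (x j)))\<^sup>2) \<partial>(\<Pi>\<^sub>M j\<in>J. M)) + ennreal ?V"
  proof -
    interpret J: prob_space "\<Pi>\<^sub>M j\<in>J. M" by (intro prob_space_PiM prob_space_axioms)
    show ?thesis unfolding inner by (subst nn_integral_add) (auto simp: J.emeasure_space_1)
  qed
  also have "\<dots> = ennreal (real (card (insert i J)) * ?V)"
    unfolding insert.IH using insert.hyps V
    by (simp add: algebra_simps flip: ennreal_plus)
  finally show ?case .
qed

text \<open>The form in which independence of past and fresh samples is used: \<open>W\<close>
  ignores coordinate \<open>k\<close>, so that coordinate can be integrated out with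
  \<open>W\<close> fixed. Both sides reduce to an integral over the remaining coordinates, on the
  right because coordinate \<open>k\<close> has total mass 1.\<close>

lemma nn_integral_PiM_split_coordinate:
  assumes M: "\<And>i. prob_space (M i)" and K: "finite K" "k \<in> K"
    and \<phi>: "(\<lambda>x. \<phi> (W x) (x k)) \<in> borel_measurable (Pi\<^sub>M K M)"
      "(\<lambda>x. \<integral>\<^sup>+y. \<phi> (W x) y \<partial>M k) \<in> borel_measurable (Pi\<^sub>M K M)"
    and W: "\<And>x y. W (x(k := y)) = W x"
  shows "(\<integral>\<^sup>+x. \<phi> (W x) (x k) \<partial>Pi\<^sub>M K M) = (\<integral>\<^sup>+x. (\<integral>\<^sup>+y. \<phi> (W x) y \<partial>M k) \<partial>Pi\<^sub>M K M)"
proof -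
  interpret P: product_prob_space M
    using M by (simp add: product_prob_space_def product_prob_space_axioms_def
        product_sigma_finite_def prob_space_imp_sigma_finite)
  define K' where "K' = K - {k}"
  have K': "finite K'" "k \<notin> K'" "K = insert k K'" using K by (auto simp: K'_def)
  have "(\<integral>\<^sup>+x. \<phi> (W x) (x k) \<partial>Pi\<^sub>M K M) = (\<integral>\<^sup>+x. (\<integral>\<^sup>+y. \<phi> (W x) y \<partial>M k) \<partial>Pi\<^sub>M K' M)"
    using P.product_nn_integral_insert[OF K'(1,2) \<phi>(1)[unfolded K'(3)]] by (simp add: W K'(3))
  also have "\<dots> = (\<integral>\<^sup>+x. (\<integral>\<^sup>+y. \<phi> (W x) y \<partial>M k) \<partial>Pi\<^sub>M K M)"
    using P.product_nn_integral_insert[OF K'(1,2) \<phi>(2)[unfolded K'(3)]]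
    by (simp add: W K'(3) prob_space.emeasure_space_1[OF M])
  finally show ?thesis .
qed

text \<open>A uniform index independent of the samples turns the expectation into an arithmetic
  mean. Countability of the index set makes sectionwise measurability enough.\<close>

lemma nn_integral_uniform_count_pair:
  assumes A: "finite A" and M: "sigma_finite_measure M"
    and f: "\<And>a. a \<in> A \<Longrightarrow> f a \<in> borel_measurable M"
  shows "(\<integral>\<^sup>+x. f (fst x) (snd x) \<partial>(uniform_count_measure A \<Otimes>\<^sub>M M)) =
    ennreal (1 / card A) * (\<Sum>a\<in>A. \<integral>\<^sup>+y. f a y \<partial>M)"
proof -
  interpret sigma_finite_measure M by (rule M)
  have "(\<lambda>x. f (fst x) (snd x)) \<in> borel_measurable (count_space A \<Otimes>\<^sub>M M)"
    using f A by (intro measurable_pair_measure_countable1) (auto simp: countable_finite)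
  also have "borel_measurable (count_space A \<Otimes>\<^sub>M M) = borel_measurable (uniform_count_measure A \<Otimes>\<^sub>M M)"
    by (intro measurable_cong_sets sets_pair_measure_cong)
      (auto simp: sets_uniform_count_measure)
  finally have "(\<integral>\<^sup>+x. f (fst x) (snd x) \<partial>(uniform_count_measure A \<Otimes>\<^sub>M M)) =
    (\<integral>\<^sup>+a. (\<integral>\<^sup>+y. f a y \<partial>M) \<partial>uniform_count_measure A)"
    by (simp flip: nn_integral_fst)
  also have "\<dots> = ennreal (1 / card A) * (\<Sum>a\<in>A. \<integral>\<^sup>+y. f a y \<partial>M)"
    using A by (simp add: uniform_count_measure_def nn_integral_point_measure_finite sum_distrib_left)
  finally show ?thesis .
qed

section \<open>Stochastic descent on the Moreau envelope\<close>

text \<open>The analysis fixes one \<open>lam\<close> and an abstract unbiased oracle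
  \<open>G\<close>; the dependence of the parameters on \<open>N\<close> enters only at the
  end.\<close>

locale prox_sgd = prob_space P for P :: "'b measure" +
  fixes f g :: "'a::euclidean_space \<Rightarrow> real" and G :: "'a \<Rightarrow> 'b \<Rightarrow> 'a" and z :: "'a \<Rightarrow> 'a"
    and L l \<sigma> lam :: real
  assumes smooth: "smooth_with L f" and lipschitz: "l-lipschitz_on UNIV g"
    and G_measurable: "case_prod G \<in> borel_measurable (borel \<Otimes>\<^sub>M P)"
    and G_integrable: "\<And>w. integrable P (G w)"
    and G_mean: "\<And>w. (\<integral>y. G w y \<partial>P) = grad f w"
    and G_variance: "\<And>w. (\<integral>\<^sup>+y. ennreal ((norm (G w y - grad f w))\<^sup>2) \<partial>P) \<le> ennreal (\<sigma>\<^sup>2)"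
    and z_prox: "\<And>w. z w \<in> prox lam g w" and z_measurable: "z \<in> borel_measurable borel"
    and lam_pos: "lam > 0"
begin

text \<open>The potential: \<open>f\<close> plus the Moreau envelope of \<open>g\<close>, written at
  the selected minimizer instead of as an infimum, so that measurability is inherited from
  \<open>z\<close>.\<close>

definition envelope :: "'a \<Rightarrow> real" where
  "envelope w = f w + (1 / (2 * lam) * (norm (w - z w))\<^sup>2 + g (z w))"

text \<open>The mean, up to sign, of the direction of a step. The envelope need not be
  differentiable, so this is in general only the gradient of a majorant of it.\<close>

definition drift :: "'a \<Rightarrow> 'a" where
  "drift w = grad f w + (1 / lam) *\<^sub>R (w - z w)"

definition batch_noise :: "nat \<Rightarrow> 'a \<Rightarrow> (nat \<Rightarrow> 'b) \<Rightarrow> 'a" where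
  "batch_noise M w y = (1 / real M) *\<^sub>R (\<Sum>j=1..M. G w (y j) - grad f w)"

lemma L_nonneg: "0 \<le> L" using smooth by (rule smooth_with_nonneg)

lemma l_nonneg: "0 \<le> l" using lipschitz by (rule lipschitz_on_nonneg)

lemma grad_measurable [measurable]: "grad f \<in> borel_measurable borel"
  using smooth_with_continuous_grad[OF smooth] by (rule borel_measurable_continuous_onI)

lemma f_measurable [measurable]: "f \<in> borel_measurable borel"
  using smooth_with_continuous[OF smooth] by (rule borel_measurable_continuous_onI)

lemma g_measurable [measurable]: "g \<in> borel_measurable borel"
  using lipschitz_on_continuous_on[OF lipschitz] by (rule borel_measurable_continuous_onI)

declare z_measurable [measurable]

lemma G_measurable' [measurable (raw)]:
  assumes "u \<in> borel_measurable N" "v \<in> N \<rightarrow>\<^sub>M P"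
  shows "(\<lambda>x. G (u x) (v x)) \<in> borel_measurable N"
  using measurable_compose[OF measurable_Pair[OF assms] G_measurable] by simp

lemma envelope_measurable [measurable]: "envelope \<in> borel_measurable borel"
  unfolding envelope_def[abs_def] by measurable

lemma drift_measurable [measurable]: "drift \<in> borel_measurable borel"
  unfolding drift_def[abs_def] by measurable

text \<open>Replacing the proximal point of \<open>v\<close> by that of \<open>w\<close> majorizes the envelope at \<open>v\<close>
  by a smooth function that touches it at \<open>w\<close> with gradient \<open>drift w\<close>.\<close>

lemma envelope_descent:
  "envelope v \<le> envelope w + drift w \<bullet> (v - w) + (L + 1 / lam) / 2 * (norm (v - w))\<^sup>2"
proof -
  have "1 / (2 * lam) * (norm (v - z v))\<^sup>2 + g (z v) \<le> 1 / (2 * lam) * (norm (v - z w))\<^sup>2 + g (z w)"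
    by (rule prox_le[OF z_prox])
  also have "1 / (2 * lam) * (norm (v - z w))\<^sup>2 = 1 / (2 * lam) * (norm (w - z w))\<^sup>2
      + (1 / lam) * ((w - z w) \<bullet> (v - w)) + 1 / (2 * lam) * (norm (v - w))\<^sup>2"
    using lam_pos norm_sq_shift[of v "z w" w] by (simp add: field_simps)
  finally show ?thesis
    using smooth_with_upper[OF smooth, of v w]
    by (simp add: envelope_def drift_def algebra_simps add_divide_distrib)
qed

lemma envelope_le: "envelope w \<le> f w + g w"
  using prox_le[OF z_prox, of w w] by (simp add: envelope_def)

text \<open>Moving from \<open>w\<close> to \<open>z w\<close> lowers \<open>g\<close> by at most
  \<open>l\<close> times the distance and pays a quadratic penalty. The worst distance is
  \<open>l * lam\<close>, whence the completed square. A lower bound of \<open>f + g\<close> thus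
  yields one for the potential.\<close>

lemma envelope_ge: "f w + g w - l\<^sup>2 * lam / 2 \<le> envelope w"
proof -
  let ?t = "norm (w - z w)"
  have "g w - g (z w) \<le> l * ?t"
    using lipschitz_onD[OF lipschitz, of w "z w"] by (simp add: dist_norm)
  moreover have "0 \<le> (?t - l * lam)\<^sup>2 / (2 * lam)"
    using lam_pos by simp
  then have "l * ?t \<le> 1 / (2 * lam) * ?t\<^sup>2 + l\<^sup>2 * lam / 2"
    using lam_pos by (simp add: field_simps power2_eq_square)
  ultimately show ?thesis by (simp add: envelope_def)
qed

text \<open>This is why the proximal point is the output: a small drift at \<open>w\<close> makes
  \<open>z w\<close> nearly stationary, but not necessarily \<open>w\<close>.\<close>

lemma edist_subdiff_le:
  "edist 0 (limiting_subdiff (\<lambda>x. f x + g x) (z w)) \<le> ennreal (norm (drift w) + 2 * L * l * lam)"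
proof -
  let ?v = "grad f (z w) + (1 / lam) *\<^sub>R (w - z w)"
  have "?v \<in> limiting_subdiff (\<lambda>x. f x + g x) (z w)"
    using prox_frechet_subdiff[OF z_prox lam_pos smooth] frechet_subset_limiting_subdiff by blast
  then have "edist 0 (limiting_subdiff (\<lambda>x. f x + g x) (z w)) \<le> ennreal (dist 0 ?v)"
    by (rule edist_le)
  also have "dist 0 ?v \<le> norm (drift w) + 2 * L * l * lam"
  proof -
    have "norm (grad f w - grad f (z w)) \<le> L * norm (w - z w)"
      using smooth by (simp add: smooth_with_def)
    also have "\<dots> \<le> L * (2 * l * lam)"
      using prox_norm_le[OF z_prox lam_pos lipschitz] L_nonneg by (rule mult_left_mono)
    finally have "norm (drift w - ?v) \<le> 2 * L * l * lam" by (simp add: drift_def)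
    then show ?thesis
      using norm_triangle_ineq2[of ?v "drift w"] by (simp add: norm_minus_commute)
  qed
  finally show ?thesis by (simp add: ennreal_leI)
qed

section \<open>Moments of the mini-batch noise\<close>

lemma batch_noise_eq:
  assumes "M > 0"
  shows "(1 / real M) *\<^sub>R (\<Sum>j=1..M. G w (y j)) = grad f w + batch_noise M w y"
  using assms by (simp add: batch_noise_def sum_subtractf scaleR_diff_right sum_constant_scaleR)

text \<open>Independence divides the variance by the batch size. The integrability claims serve the
  descent step, where a quadratic in the noise is integrated term by term.\<close>

lemma batch_noise_moments:
  fixes M :: nat
  assumes M: "M > 0"
  defines "Q \<equiv> \<Pi>\<^sub>M j\<in>{1..M}. P"
  shows "integrable Q (batch_noise M w)" "(\<integral>y. batch_noise M w y \<partial>Q) = 0"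
    "integrable Q (\<lambda>y. (norm (batch_noise M w y))\<^sup>2)"
    "(\<integral>y. (norm (batch_noise M w y))\<^sup>2 \<partial>Q) \<le> \<sigma>\<^sup>2 / M"
proof -
  define D where "D y = G w y - grad f w" for y
  have [measurable]: "D \<in> borel_measurable P" unfolding D_def[abs_def] by measurable
  have D: "integrable P D" "(\<integral>y. D y \<partial>P) = 0"
    using G_integrable by (auto simp: D_def[abs_def] G_mean prob_space)
  \<comment> \<open>The variance hypothesis bounds a nonnegative integral, and its finiteness gives
    square integrability.\<close>
  have D2: "integrable P (\<lambda>y. (norm (D y))\<^sup>2)"
    using G_variance[of w] by (intro integrableI_nonneg) (auto simp: D_def le_less_trans)
  have V: "(\<integral>y. (norm (D y))\<^sup>2 \<partial>P) \<le> \<sigma>\<^sup>2"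
    using G_variance[of w] nn_integral_eq_integral[OF D2] by (simp add: D_def)
  have noise: "batch_noise M w y = (1 / real M) *\<^sub>R (\<Sum>j=1..M. D (y j))" for y
    by (simp add: batch_noise_def D_def)
  \<comment> \<open>Each coordinate of the product has law \<open>P\<close>.\<close>
  have component: "integrable Q (\<lambda>y. D (y j))" "(\<integral>y. D (y j) \<partial>Q) = 0" if "j \<in> {1..M}" for j
  proof -
    have distr: "distr Q P (\<lambda>y. y j) = P"
      unfolding Q_def using that prob_space_axioms by (intro distr_PiM_component)
    have meas: "(\<lambda>y. y j) \<in> Q \<rightarrow>\<^sub>M P"
      using that unfolding Q_def by measurable
    show "integrable Q (\<lambda>y. D (y j))"
      using integrable_distr_eq[OF meas, of D] distr D by simp
    show "(\<integral>y. D (y j) \<partial>Q) = 0"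
      using integral_distr[OF meas, of D] distr D by simp
  qed
  show int: "integrable Q (batch_noise M w)"
    unfolding noise using component by (intro integrable_scaleR_right Bochner_Integration.integrable_sum)
  show "(\<integral>y. batch_noise M w y \<partial>Q) = 0"
    unfolding noise using component by simp
  have "(\<integral>\<^sup>+y. ennreal ((norm (\<Sum>j=1..M. D (y j)))\<^sup>2) \<partial>Q) = ennreal (M * (\<integral>y. (norm (D y))\<^sup>2 \<partial>P))"
    unfolding Q_def by (subst nn_integral_PiM_norm_sum[OF D D2]) auto
  also have "\<dots> \<le> ennreal (M * \<sigma>\<^sup>2)"
    using V by (intro ennreal_leI mult_left_mono) auto
  finally have "ennreal ((1 / M)\<^sup>2) * (\<integral>\<^sup>+y. ennreal ((norm (\<Sum>j=1..M. D (y j)))\<^sup>2) \<partial>Q)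
      \<le> ennreal ((1 / M)\<^sup>2) * ennreal (M * \<sigma>\<^sup>2)"
    by (rule mult_left_mono) simp
  also have "\<dots> = ennreal (\<sigma>\<^sup>2 / M)"
    using M by (simp add: power2_eq_square flip: ennreal_mult)
  also have "ennreal ((1 / M)\<^sup>2) * (\<integral>\<^sup>+y. ennreal ((norm (\<Sum>j=1..M. D (y j)))\<^sup>2) \<partial>Q)
      = (\<integral>\<^sup>+y. ennreal ((norm (batch_noise M w y))\<^sup>2) \<partial>Q)"
    unfolding Q_def by (subst nn_integral_cmult[symmetric])
      (auto simp: noise power_mult_distrib power_divide simp flip: ennreal_mult)
  finally have le: "(\<integral>\<^sup>+y. ennreal ((norm (batch_noise M w y))\<^sup>2) \<partial>Q) \<le> ennreal (\<sigma>\<^sup>2 / M)" .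
  show int2: "integrable Q (\<lambda>y. (norm (batch_noise M w y))\<^sup>2)"
    using le int by (intro integrableI_nonneg) (auto simp: le_less_trans)
  show "(\<integral>y. (norm (batch_noise M w y))\<^sup>2 \<partial>Q) \<le> \<sigma>\<^sup>2 / M"
    using le nn_integral_eq_integral[OF int2] by simp
qed

section \<open>Expected decrease in one step\<close>

definition step :: "nat \<Rightarrow> real \<Rightarrow> 'a \<Rightarrow> (nat \<Rightarrow> 'b) \<Rightarrow> 'a" where
  "step M \<gamma> w y = w - \<gamma> *\<^sub>R ((1 / real M) *\<^sub>R (\<Sum>j=1..M. G w (y j)) + (1 / lam) *\<^sub>R (w - z w))"

lemma step_measurable [measurable (raw)]:
  assumes [measurable]: "u \<in> borel_measurable N" "v \<in> N \<rightarrow>\<^sub>M (\<Pi>\<^sub>M j\<in>{1..M}. P)"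
  shows "(\<lambda>x. step M \<gamma> (u x) (v x)) \<in> borel_measurable N"
proof -
  have [measurable]: "(\<lambda>x. v x j) \<in> N \<rightarrow>\<^sub>M P" if "j \<in> {1..M}" for j
    using measurable_compose[OF assms(2) measurable_component_singleton[OF that]] .
  show ?thesis unfolding step_def by measurable
qed

text \<open>In the mean of the majorant the term linear in the noise vanishes, and the step size
  condition lets half of the first-order decrease absorb the quadratic drift term. Subtracting
  \<open>m\<close> keeps the integrand nonnegative, and the drift stands on the left so that no
  extended reals are subtracted.\<close>

lemma step_expectation:
  assumes M: "M > 0" and \<gamma>: "0 < \<gamma>" "\<gamma> * (L + 1 / lam) \<le> 1"
    and m: "\<And>w. m \<le> envelope w"
  shows "(\<integral>\<^sup>+y. ennreal (envelope (step M \<gamma> w y) - m) \<partial>(\<Pi>\<^sub>M j\<in>{1..M}. P))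
      + ennreal (\<gamma> / 2 * (norm (drift w))\<^sup>2)
    \<le> ennreal (envelope w - m) + ennreal ((L + 1 / lam) * \<gamma>\<^sup>2 * \<sigma>\<^sup>2 / (2 * M))"
proof -
  define Q where "Q = (\<Pi>\<^sub>M j\<in>{1..M}. P)"
  interpret Q: prob_space Q unfolding Q_def by (intro prob_space_PiM prob_space_axioms)
  define E where "E = L + 1 / lam"
  have E: "0 < E" using L_nonneg lam_pos by (simp add: E_def add_nonneg_pos)
  let ?u = "drift w" and ?\<delta> = "batch_noise M w"
  note moments = batch_noise_moments[OF M, of w, folded Q_def]
  \<comment> \<open>The quadratic majorant at the displacement
    \<open>- \<gamma> * (?u + ?\<delta> y)\<close>, less \<open>m\<close>. Its integral is explicit,
    unlike that of the envelope.\<close>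
  define B where "B y = (envelope w - m) - \<gamma> * (norm ?u)\<^sup>2 - \<gamma> * (?\<delta> y \<bullet> ?u)
      + E / 2 * \<gamma>\<^sup>2 * ((norm ?u)\<^sup>2 + 2 * (?\<delta> y \<bullet> ?u) + (norm (?\<delta> y))\<^sup>2)" for y
  have pointwise: "envelope (step M \<gamma> w y) - m \<le> B y" for y
  proof -
    have "step M \<gamma> w y - w = - \<gamma> *\<^sub>R (?u + ?\<delta> y)"
      unfolding step_def batch_noise_eq[OF M] drift_def by (simp add: algebra_simps)
    then have "envelope (step M \<gamma> w y) \<le> envelope w + ?u \<bullet> (- \<gamma> *\<^sub>R (?u + ?\<delta> y))
        + E / 2 * (norm (- \<gamma> *\<^sub>R (?u + ?\<delta> y)))\<^sup>2"
      using envelope_descent[of "step M \<gamma> w y" w] by (simp add: E_def)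
    also have "(norm (- \<gamma> *\<^sub>R (?u + ?\<delta> y)))\<^sup>2 =
        \<gamma>\<^sup>2 * ((norm ?u)\<^sup>2 + 2 * (?\<delta> y \<bullet> ?u) + (norm (?\<delta> y))\<^sup>2)"
      unfolding norm_scaleR power_mult_distrib power2_abs power2_minus abs_minus_cancel
      by (simp add: power2_norm_eq_inner algebra_simps inner_commute)
    finally show ?thesis
      by (simp add: B_def power2_norm_eq_inner inner_commute algebra_simps)
  qed
  have int: "integrable Q B"
    unfolding B_def using moments by (intro Bochner_Integration.integrable_add
        Bochner_Integration.integrable_diff integrable_mult_right integrable_inner_left) auto
  have B_nonneg: "0 \<le> B y" for y
    using pointwise[of y] m[of "step M \<gamma> w y"] by simp
  have "(\<integral>y. B y \<partial>Q) = (envelope w - m) - \<gamma> * (norm ?u)\<^sup>2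
      + E / 2 * \<gamma>\<^sup>2 * ((norm ?u)\<^sup>2 + (\<integral>y. (norm (?\<delta> y))\<^sup>2 \<partial>Q))"
    unfolding B_def using moments by (simp add: Q.prob_space)
  also have "\<dots> \<le> (envelope w - m) - \<gamma> * (norm ?u)\<^sup>2 + E / 2 * \<gamma>\<^sup>2 * ((norm ?u)\<^sup>2 + \<sigma>\<^sup>2 / M)"
    using moments E by (intro add_left_mono mult_left_mono) auto
  also have "\<dots> \<le> (envelope w - m) + E * \<gamma>\<^sup>2 * \<sigma>\<^sup>2 / (2 * M) - \<gamma> / 2 * (norm ?u)\<^sup>2"
  proof -
    \<comment> \<open>The quadratic drift term costs at most half of the decrease
      \<open>\<gamma> * (norm ?u)^2\<close>.\<close>
    have "(\<gamma> / 2 * (norm ?u)\<^sup>2) * (\<gamma> * E) \<le> (\<gamma> / 2 * (norm ?u)\<^sup>2) * 1"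
      using \<gamma> by (intro mult_left_mono) (auto simp: E_def)
    then show ?thesis by (simp add: algebra_simps power2_eq_square)
  qed
  finally have EB: "(\<integral>y. B y \<partial>Q) + \<gamma> / 2 * (norm ?u)\<^sup>2 \<le> (envelope w - m) + E * \<gamma>\<^sup>2 * \<sigma>\<^sup>2 / (2 * M)"
    by simp
  have "(\<integral>\<^sup>+y. ennreal (envelope (step M \<gamma> w y) - m) \<partial>Q) \<le> (\<integral>\<^sup>+y. ennreal (B y) \<partial>Q)"
    using pointwise by (intro nn_integral_mono ennreal_leI)
  also have "\<dots> = ennreal (\<integral>y. B y \<partial>Q)"
    using int B_nonneg by (intro nn_integral_eq_integral) auto
  finally have "(\<integral>\<^sup>+y. ennreal (envelope (step M \<gamma> w y) - m) \<partial>Q) + ennreal (\<gamma> / 2 * (norm ?u)\<^sup>2)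
      \<le> ennreal (\<integral>y. B y \<partial>Q) + ennreal (\<gamma> / 2 * (norm ?u)\<^sup>2)"
    by (rule add_right_mono)
  also have "\<dots> = ennreal ((\<integral>y. B y \<partial>Q) + \<gamma> / 2 * (norm ?u)\<^sup>2)"
    using B_nonneg \<gamma> by (intro ennreal_plus[symmetric] integral_nonneg) auto
  also have "\<dots> \<le> ennreal ((envelope w - m) + E * \<gamma>\<^sup>2 * \<sigma>\<^sup>2 / (2 * M))"
    using EB by (rule ennreal_leI)
  also have "\<dots> = ennreal (envelope w - m) + ennreal (E * \<gamma>\<^sup>2 * \<sigma>\<^sup>2 / (2 * M))"
    using m[of w] E by (intro ennreal_plus) auto
  finally show ?thesis by (simp only: E_def Q_def)
qed


section \<open>Telescoping along a run\<close>

abbreviation iterate_at :: "nat \<Rightarrow> real \<Rightarrow> 'a \<Rightarrow> nat \<Rightarrow> (nat \<Rightarrow> nat \<Rightarrow> 'b) \<Rightarrow> 'a" where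
  "iterate_at M \<gamma> w1 n xi \<equiv> iterate (mbsga_loop G z M lam \<gamma> w1 xi n)"

lemma iterate_at_Suc: "iterate_at M \<gamma> w1 (Suc n) xi = step M \<gamma> (iterate_at M \<gamma> w1 n xi) (xi (Suc n))"
  by (simp add: Let_def step_def)

text \<open>The first \<open>n\<close> steps read only the batches \<open>1\<close> to
  \<open>n\<close>; this makes every later batch independent of the iterate.\<close>

lemma iterate_at_fun_upd: "n < k \<Longrightarrow> iterate_at M \<gamma> w1 n (xi(k := y)) = iterate_at M \<gamma> w1 n xi"
proof (induction n)
  case (Suc n)
  then show ?case by (simp del: mbsga_loop.simps add: iterate_at_Suc)
qed simp

text \<open>The index set is general because all iterates live on the sample space of a whole run,
  although each reads only an initial part of it.\<close>

lemma iterate_at_measurable: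
  assumes "{1..n} \<subseteq> K"
  shows "iterate_at M \<gamma> w1 n \<in> borel_measurable (\<Pi>\<^sub>M k\<in>K. \<Pi>\<^sub>M j\<in>{1..M}. P)"
  using assms
proof (induction n)
  case (Suc n)
  then have [measurable]: "iterate_at M \<gamma> w1 n \<in> borel_measurable (\<Pi>\<^sub>M k\<in>K. \<Pi>\<^sub>M j\<in>{1..M}. P)"
    by (intro Suc.IH) auto
  have "Suc n \<in> K" using Suc.prems by auto
  then have [measurable]: "(\<lambda>xi. xi (Suc n)) \<in> (\<Pi>\<^sub>M k\<in>K. \<Pi>\<^sub>M j\<in>{1..M}. P) \<rightarrow>\<^sub>M (\<Pi>\<^sub>M j\<in>{1..M}. P)"
    by (rule measurable_component_singleton)
  show ?case unfolding iterate_at_Suc by measurable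
qed simp

text \<open>Telescopes the one-step inequality. The final potential stays on the left: it carries
  the induction and later pays for one more drift term.\<close>

lemma sum_expected_drift:
  fixes M n :: nat and K :: "nat set" and w1 :: 'a and c :: real
  assumes K: "finite K" "{1..n} \<subseteq> K"
    and M: "M > 0" and \<gamma>: "0 < \<gamma>" "\<gamma> * (L + 1 / lam) \<le> 1"
    and m: "\<And>w. m \<le> envelope w"
  defines "\<Xi> \<equiv> \<Pi>\<^sub>M k\<in>K. \<Pi>\<^sub>M j\<in>{1..M}. P" and "W \<equiv> iterate_at M \<gamma> w1"
    and "c \<equiv> (L + 1 / lam) * \<gamma>\<^sup>2 * \<sigma>\<^sup>2 / (2 * M)"
  shows "(\<integral>\<^sup>+xi. ennreal (envelope (W n xi) - m) \<partial>\<Xi>)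
      + (\<Sum>k<n. \<integral>\<^sup>+xi. ennreal (\<gamma> / 2 * (norm (drift (W k xi)))\<^sup>2) \<partial>\<Xi>)
    \<le> ennreal (envelope w1 - m + n * c)"
  using K(2)
proof (induction n)
  let ?Q = "\<Pi>\<^sub>M j\<in>{1..M}. P"
  have Q: "prob_space ?Q" by (intro prob_space_PiM prob_space_axioms)
  interpret \<Xi>: prob_space \<Xi> unfolding \<Xi>_def by (intro prob_space_PiM Q)
  have c: "0 \<le> c" using L_nonneg lam_pos by (simp add: c_def)
  {
    case 0
    then show ?case by (simp add: W_def \<Xi>.emeasure_space_1)
  next
    case (Suc n)
    then have n: "{1..n} \<subseteq> K" "Suc n \<in> K" by auto
    have W [measurable]: "W n \<in> borel_measurable \<Xi>"
      unfolding W_def \<Xi>_def using n(1) by (rule iterate_at_measurable)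
    have [measurable]: "(\<lambda>xi. xi (Suc n)) \<in> \<Xi> \<rightarrow>\<^sub>M ?Q"
      unfolding \<Xi>_def using n(2) by (rule measurable_component_singleton)
    interpret Q: prob_space ?Q by (rule Q)
    define \<phi> where "\<phi> w y = ennreal (envelope (step M \<gamma> w y) - m)" for w y
    let ?S = "\<Sum>k<n. \<integral>\<^sup>+xi. ennreal (\<gamma> / 2 * (norm (drift (W k xi)))\<^sup>2) \<partial>\<Xi>"
    let ?d = "\<integral>\<^sup>+xi. ennreal (\<gamma> / 2 * (norm (drift (W n xi)))\<^sup>2) \<partial>\<Xi>"
    have [measurable]: "(\<lambda>xi. \<integral>\<^sup>+y. \<phi> (W n xi) y \<partial>?Q) \<in> borel_measurable \<Xi>"
      unfolding \<phi>_def by measurable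
    have "(\<integral>\<^sup>+xi. ennreal (envelope (W (Suc n) xi) - m) \<partial>\<Xi>) = (\<integral>\<^sup>+xi. \<phi> (W n xi) (xi (Suc n)) \<partial>\<Xi>)"
      unfolding \<phi>_def W_def iterate_at_Suc ..
    \<comment> \<open>Batch \<open>Suc n\<close> is fresh for \<open>W n\<close>, so it is
      integrated out with the iterate held fixed.\<close>
    also have "\<dots> = (\<integral>\<^sup>+xi. (\<integral>\<^sup>+y. \<phi> (W n xi) y \<partial>?Q) \<partial>\<Xi>)"
      unfolding \<Xi>_def
    proof (rule nn_integral_PiM_split_coordinate[OF Q K(1) n(2), of \<phi> "W n"])
      show "(\<lambda>xi. \<phi> (W n xi) (xi (Suc n))) \<in> borel_measurable (\<Pi>\<^sub>M k\<in>K. ?Q)"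
        unfolding \<Xi>_def[symmetric] \<phi>_def by measurable
      show "(\<lambda>xi. \<integral>\<^sup>+y. \<phi> (W n xi) y \<partial>?Q) \<in> borel_measurable (\<Pi>\<^sub>M k\<in>K. ?Q)"
        unfolding \<Xi>_def[symmetric] by measurable
    qed (simp add: W_def iterate_at_fun_upd)
    finally have "(\<integral>\<^sup>+xi. ennreal (envelope (W (Suc n) xi) - m) \<partial>\<Xi>) + ?d
        = (\<integral>\<^sup>+xi. (\<integral>\<^sup>+y. \<phi> (W n xi) y \<partial>?Q) \<partial>\<Xi>) + ?d"
      by (rule arg_cong)
    also have "\<dots> = (\<integral>\<^sup>+xi. (\<integral>\<^sup>+y. \<phi> (W n xi) y \<partial>?Q) + ennreal (\<gamma> / 2 * (norm (drift (W n xi)))\<^sup>2) \<partial>\<Xi>)"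
      by (rule nn_integral_add[symmetric]) measurable
    also have "\<dots> \<le> (\<integral>\<^sup>+xi. ennreal (envelope (W n xi) - m) + ennreal c \<partial>\<Xi>)"
      unfolding \<phi>_def c_def by (intro nn_integral_mono step_expectation M \<gamma> m)
    also have "\<dots> = (\<integral>\<^sup>+xi. ennreal (envelope (W n xi) - m) \<partial>\<Xi>) + ennreal c"
      by (subst nn_integral_add) (auto simp: \<Xi>.emeasure_space_1)
    finally have "(\<integral>\<^sup>+xi. ennreal (envelope (W (Suc n) xi) - m) \<partial>\<Xi>) + ?d + ?S
        \<le> (\<integral>\<^sup>+xi. ennreal (envelope (W n xi) - m) \<partial>\<Xi>) + ennreal c + ?S"
      by (rule add_right_mono)
    also have "\<dots> \<le> ennreal (envelope w1 - m + n * c) + ennreal c"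
      using add_right_mono[OF Suc.IH[OF n(1)], of "ennreal c"] by (simp add: ac_simps)
    also have "\<dots> = ennreal (envelope w1 - m + Suc n * c)"
      using m[of w1] c by (subst ennreal_plus[symmetric]) (auto simp: algebra_simps intro: add_increasing)
    finally show ?case by (simp add: ac_simps)
  }
qed

text \<open>The hypothesis on \<open>s\<close> says that \<open>s^2\<close> dominates the telescoped
  bound on the mean squared drift over the \<open>N\<close> candidate iterates.\<close>

lemma mean_edist_le:
  fixes M N :: nat and \<gamma> m s :: real
  assumes N: "N > 0" and M: "M > 0" and \<gamma>: "0 < \<gamma>" "\<gamma> * (L + 1 / lam) \<le> 1"
    and m: "\<And>w. m \<le> envelope w"
    and s: "0 < s" "2 * (envelope w1 - m) / (N * \<gamma>) + (L + 1 / lam) * \<gamma> * \<sigma>\<^sup>2 / M \<le> s\<^sup>2"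
  shows "(\<integral>\<^sup>+\<omega>. edist 0 (limiting_subdiff (\<lambda>x. f x + g x)
        (z (iterate_at M \<gamma> w1 (fst \<omega> - 1) (snd \<omega>))))
      \<partial>(uniform_count_measure {1..N} \<Otimes>\<^sub>M (\<Pi>\<^sub>M k\<in>{1..<N}. \<Pi>\<^sub>M j\<in>{1..M}. P)))
    \<le> ennreal (s + 2 * L * l * lam)"
proof -
  let ?Q = "\<Pi>\<^sub>M j\<in>{1..M}. P"
  define \<Xi> where "\<Xi> = (\<Pi>\<^sub>M k\<in>{1..<N}. ?Q)"
  interpret \<Xi>: prob_space \<Xi>
    unfolding \<Xi>_def by (intro prob_space_PiM prob_space_axioms)
  define W where "W = iterate_at M \<gamma> w1"
  define c where "c = (L + 1 / lam) * \<gamma>\<^sup>2 * \<sigma>\<^sup>2 / (2 * M)"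
  define d where "d w = ennreal (\<gamma> / 2 * (norm (drift w))\<^sup>2)" for w
  have [measurable]: "d \<in> borel_measurable borel" unfolding d_def[abs_def] by measurable
  have c: "0 \<le> c" using L_nonneg lam_pos by (simp add: c_def)
  have W [measurable]: "W k \<in> borel_measurable \<Xi>" if "k < N" for k
    unfolding W_def \<Xi>_def using that by (intro iterate_at_measurable) auto
  obtain n where n: "N = Suc n" using N by (cases N) auto
  \<comment> \<open>The output may use \<open>N\<close> iterates, but the batches \<open>1\<close>
    to \<open>N - 1\<close> allow only \<open>N - 1\<close> steps. The last drift is bounded by a
    virtual further step, after which the potential is still nonnegative.\<close>
  have "d w \<le> ennreal (envelope w - m) + ennreal c" for w
    using step_expectation[OF M \<gamma> m, of w] unfolding d_def c_def
    by (rule order_trans[rotated]) simp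
  then have "(\<integral>\<^sup>+xi. d (W n xi) \<partial>\<Xi>) \<le> (\<integral>\<^sup>+xi. ennreal (envelope (W n xi) - m) + ennreal c \<partial>\<Xi>)"
    by (intro nn_integral_mono)
  also have "\<dots> = (\<integral>\<^sup>+xi. ennreal (envelope (W n xi) - m) \<partial>\<Xi>) + ennreal c"
    using W[of n] n by (subst nn_integral_add) (auto simp: \<Xi>.emeasure_space_1)
  finally have "(\<integral>\<^sup>+xi. d (W n xi) \<partial>\<Xi>) + (\<Sum>k<n. \<integral>\<^sup>+xi. d (W k xi) \<partial>\<Xi>)
      \<le> ((\<integral>\<^sup>+xi. ennreal (envelope (W n xi) - m) \<partial>\<Xi>) + ennreal c)
        + (\<Sum>k<n. \<integral>\<^sup>+xi. d (W k xi) \<partial>\<Xi>)"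
    by (rule add_right_mono)
  also have "\<dots> \<le> ennreal (envelope w1 - m + n * c) + ennreal c"
  proof -
    have "(\<integral>\<^sup>+xi. ennreal (envelope (W n xi) - m) \<partial>\<Xi>) + (\<Sum>k<n. \<integral>\<^sup>+xi. d (W k xi) \<partial>\<Xi>)
        \<le> ennreal (envelope w1 - m + n * c)"
      unfolding W_def \<Xi>_def d_def c_def using n by (intro sum_expected_drift M \<gamma> m) auto
    from add_right_mono[OF this, of "ennreal c"] show ?thesis by (simp add: ac_simps)
  qed
  also have "\<dots> = ennreal (envelope w1 - m + N * c)"
    using m[of w1] c n by (subst ennreal_plus[symmetric]) (auto simp: algebra_simps intro: add_increasing)
  finally have sum_d: "(\<Sum>k<N. \<integral>\<^sup>+xi. d (W k xi) \<partial>\<Xi>) \<le> ennreal (envelope w1 - m + N * c)"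
    by (simp add: n add.commute)
  \<comment> \<open>The part of the pointwise bound that is independent of the drift: the remainder
    \<open>s / 2\<close> and the cost of passing from \<open>w\<close> to
    \<open>z w\<close>.\<close>
  define b where "b = s / 2 + 2 * L * l * lam"
  have b: "0 \<le> b" using s L_nonneg l_nonneg lam_pos by (simp add: b_def)
  have edist: "edist 0 (limiting_subdiff (\<lambda>x. f x + g x) (z w)) \<le> ennreal (1 / (s * \<gamma>)) * d w + ennreal b" for w
  proof -
    have "0 \<le> (norm (drift w) - s)\<^sup>2 / (2 * s)" using s by simp
    \<comment> \<open>AM-GM instead of Jensen's inequality for the square root\<close>
    then have "norm (drift w) \<le> 1 / (s * \<gamma>) * (\<gamma> / 2 * (norm (drift w))\<^sup>2) + s / 2"
      using s \<gamma> by (simp add: field_simps power2_eq_square)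
    then have "ennreal (norm (drift w) + 2 * L * l * lam)
        \<le> ennreal (1 / (s * \<gamma>) * (\<gamma> / 2 * (norm (drift w))\<^sup>2) + b)"
      by (intro ennreal_leI) (simp add: b_def)
    also have "\<dots> = ennreal (1 / (s * \<gamma>)) * d w + ennreal b"
      using s \<gamma> b unfolding d_def by (subst ennreal_plus) (auto simp flip: ennreal_mult)
    finally show ?thesis using edist_subdiff_le order_trans by blast
  qed
  have "(\<integral>\<^sup>+\<omega>. edist 0 (limiting_subdiff (\<lambda>x. f x + g x) (z (W (fst \<omega> - 1) (snd \<omega>))))
      \<partial>(uniform_count_measure {1..N} \<Otimes>\<^sub>M \<Xi>))
    \<le> (\<integral>\<^sup>+\<omega>. ennreal (1 / (s * \<gamma>)) * d (W (fst \<omega> - 1) (snd \<omega>)) + ennreal b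
      \<partial>(uniform_count_measure {1..N} \<Otimes>\<^sub>M \<Xi>))"
    by (intro nn_integral_mono edist)
  also have "\<dots> = ennreal (1 / N) * (\<Sum>k\<in>{1..N}. \<integral>\<^sup>+xi. ennreal (1 / (s * \<gamma>)) * d (W (k - 1) xi) + ennreal b \<partial>\<Xi>)"
    by (subst nn_integral_uniform_count_pair[where f="\<lambda>k xi. ennreal (1 / (s * \<gamma>)) * d (W (k - 1) xi) + ennreal b"])
      (auto intro: \<Xi>.sigma_finite_measure_axioms)
  \<comment> \<open>For \<open>R = k\<close> the output uses the iterate after \<open>k - 1\<close>
    steps.\<close>
  also have "(\<Sum>k\<in>{1..N}. \<integral>\<^sup>+xi. ennreal (1 / (s * \<gamma>)) * d (W (k - 1) xi) + ennreal b \<partial>\<Xi>)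
      = (\<Sum>k<N. \<integral>\<^sup>+xi. ennreal (1 / (s * \<gamma>)) * d (W k xi) + ennreal b \<partial>\<Xi>)"
    by (rule sum.reindex_bij_witness[of _ Suc "\<lambda>k. k - 1"]) auto
  also have "\<dots> = (\<Sum>k<N. ennreal (1 / (s * \<gamma>)) * (\<integral>\<^sup>+xi. d (W k xi) \<partial>\<Xi>) + ennreal b)"
    by (intro sum.cong refl) (simp add: nn_integral_add nn_integral_cmult \<Xi>.emeasure_space_1)
  also have "\<dots> = ennreal (1 / (s * \<gamma>)) * (\<Sum>k<N. \<integral>\<^sup>+xi. d (W k xi) \<partial>\<Xi>) + ennreal (N * b)"
    using b by (simp add: sum.distrib sum_distrib_left ennreal_mult ennreal_of_nat_eq_real_of_nat)
  also have "ennreal (1 / N) * \<dots> \<le>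
      ennreal (1 / N) * (ennreal (1 / (s * \<gamma>)) * ennreal (envelope w1 - m + N * c) + ennreal (N * b))"
    by (intro mult_left_mono add_right_mono sum_d) auto
  also have "\<dots> = ennreal (1 / N * (1 / (s * \<gamma>) * (envelope w1 - m + N * c) + N * b))"
    using m[of w1] c b s \<gamma> by (simp flip: ennreal_mult ennreal_plus)
  also have "\<dots> \<le> ennreal (s + 2 * L * l * lam)"
  proof (rule ennreal_leI)
    have "1 / N * (1 / (s * \<gamma>) * (envelope w1 - m + N * c) + N * b)
        = (2 * (envelope w1 - m) / (N * \<gamma>) + (L + 1 / lam) * \<gamma> * \<sigma>\<^sup>2 / M) / (2 * s) + b"
      using N M s \<gamma> by (simp add: c_def field_simps power2_eq_square)
    \<comment> \<open>The averaged drift contributes \<open>s / 2\<close>, which the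
      \<open>s / 2\<close> inside \<open>b\<close> completes to \<open>s\<close>.\<close>
    also have "\<dots> \<le> s\<^sup>2 / (2 * s) + b"
      using s by (intro add_right_mono divide_right_mono) auto
    also have "\<dots> = s + 2 * L * l * lam" using s by (simp add: b_def power2_eq_square)
    finally show "1 / N * (1 / (s * \<gamma>) * (envelope w1 - m + N * c) + N * b) \<le> s + 2 * L * l * lam" .
  qed
  finally show ?thesis unfolding W_def \<Xi>_def .
qed

end

section \<open>Operation counts and step size\<close>

lemma mbsga_loop_calls:
  "gradient_calls (mbsga_loop G z M lam \<gamma> w1 xi n) = n * M"
  "prox_calls (mbsga_loop G z M lam \<gamma> w1 xi n) = n"
  by (induction n) (auto simp: Let_def)

text \<open>Here \<open>r\<close> stands for the fourth root of \<open>N\<close>, so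
  \<open>r\<close> is \<open>1 / lam\<close>, \<open>r^2\<close> is \<open>sqrt N\<close> and
  \<open>r^4\<close> is \<open>N\<close>. The first summand needs \<gamma> not too small, hence a
  bound on \<open>1 / \<gamma>\<close>; the second uses \<gamma>
  \<open>\<le> 1 / (\<sigma> * r^2)\<close> and the batch size. Both are then of order
  \<open>1 / r^2\<close>.\<close>

lemma step_size_rate:
  fixes r :: real
  assumes r: "1 \<le> r" "r \<le> M" and L: "0 \<le> L" and \<sigma>: "0 < \<sigma>" and A: "0 \<le> A"
    and \<gamma>: "\<gamma> = min (1 / (L + r)) (1 / (\<sigma> * r\<^sup>2))"
  shows "A / (r ^ 4 * \<gamma>) + (L + r) * \<gamma> * \<sigma>\<^sup>2 / M \<le> (A * (L + \<sigma> + 1) + \<sigma> * (L + 1)) / r\<^sup>2"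
proof -
  have \<gamma>_pos: "0 < \<gamma>" using r L \<sigma> by (simp add: \<gamma>)
  have r2: "1 \<le> r\<^sup>2" "r \<le> r\<^sup>2" using r power_increasing[of 1 2 r] by auto
  have "1 / \<gamma> = max (L + r) (\<sigma> * r\<^sup>2)"
    using r L \<sigma> by (auto simp: \<gamma> min_def max_def field_simps)
  also have "\<dots> \<le> L * r\<^sup>2 + r\<^sup>2 + \<sigma> * r\<^sup>2"
  proof -
    have "L * 1 \<le> L * r\<^sup>2" using L r2 by (intro mult_left_mono) auto
    moreover have "0 \<le> L * r\<^sup>2" "0 \<le> \<sigma> * r\<^sup>2" using L \<sigma> by auto
    ultimately show ?thesis using r2 r by (auto simp: max_def)
  qed
  finally have inv: "1 / \<gamma> \<le> (L + \<sigma> + 1) * r\<^sup>2" by (simp add: algebra_simps)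
  have "A / (r ^ 4 * \<gamma>) = A / r ^ 4 * (1 / \<gamma>)" by simp
  also have "\<dots> \<le> A / r ^ 4 * ((L + \<sigma> + 1) * r\<^sup>2)"
    using inv A r by (intro mult_left_mono) auto
  also have "\<dots> = A * (L + \<sigma> + 1) / r\<^sup>2"
    using r by (simp add: field_simps power_numeral_reduce)
  finally have 1: "A / (r ^ 4 * \<gamma>) \<le> A * (L + \<sigma> + 1) / r\<^sup>2" .
  have "(L + r) * \<gamma> * \<sigma>\<^sup>2 / M \<le> ((L + 1) * r) * (1 / (\<sigma> * r\<^sup>2)) * \<sigma>\<^sup>2 / r"
    using r L \<sigma> \<gamma>_pos mult_left_mono[OF r(1) L]
    by (intro frac_le mult_mono) (auto simp: \<gamma> algebra_simps)
  also have "\<dots> = \<sigma> * (L + 1) / r\<^sup>2"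
    using r \<sigma> by (simp add: field_simps power2_eq_square)
  finally show ?thesis using 1 by (simp add: add_divide_distrib)
qed

section \<open>Complexity\<close>

text \<open>The expected distance is at most \<open>(C - 1) / r\<close> with \<open>r\<close> the
  fourth root of \<open>N\<close>, so \<open>r\<close> of order \<open>1 / \<epsilon>\<close>
  suffices. A run makes at most \<open>N\<close> proximal operations, of order \<open>r^4\<close>,
  and each iteration draws about \<open>r\<close> samples, which gives \<open>r^5\<close> gradient
  calls.\<close>

theorem corollary6:
  fixes f g h :: "real ^ 'd \<Rightarrow> real"
    and F :: "real ^ 'd \<Rightarrow> real ^ 'p \<Rightarrow> real"
    and P :: "(real ^ 'p) measure"
    and \<zeta> :: "real \<Rightarrow> real ^ 'd \<Rightarrow> real ^ 'd"
    and w1 wstar :: "real ^ 'd"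
    and L l \<sigma> \<Delta> :: real
  assumes P_prob: "prob_space P"
    and P_borel: "sets P = sets borel"
    and F_integrable: "\<And>w. integrable P (F w)"
    and f_eq: "\<And>w. f w = (\<integral>\<xi>. F w \<xi> \<partial>P)"
    and f_smooth: "smooth_with L f"
    and F_differentiable: "\<And>w \<xi>. (\<lambda>v. F v \<xi>) differentiable (at w)"
    and grad_F_integrable: "\<And>w. integrable P (\<lambda>\<xi>. grad (\<lambda>v. F v \<xi>) w)"
    and grad_F_unbiased: "\<And>w. (\<integral>\<xi>. grad (\<lambda>v. F v \<xi>) w \<partial>P) = grad f w"
    and sigma_pos: "\<sigma> > 0"
    and grad_F_variance:
      "\<And>w. (\<integral>\<^sup>+\<xi>. ennreal ((norm (grad (\<lambda>v. F v \<xi>) w - grad f w))\<^sup>2) \<partial>P) \<le> ennreal (\<sigma>\<^sup>2)"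
    and g_lipschitz: "l-lipschitz_on UNIV g"
    and prox_nonempty: "\<And>lam w. lam > 0 \<Longrightarrow> prox lam g w \<noteq> {}"
    and zeta_prox: "\<And>lam w. lam > 0 \<Longrightarrow> \<zeta> lam w \<in> prox lam g w"
    and zeta_measurable: "\<And>lam. lam > 0 \<Longrightarrow> \<zeta> lam \<in> borel_measurable borel"
    and h_eq: "h = (\<lambda>w. f w + g w)"
    and wstar_minimizer: "\<And>w. h wstar \<le> h w"
    and Delta_eq: "\<Delta> = 2 * (h w1 - h wstar)"
  shows "\<forall>\<epsilon>::real. 0 < \<epsilon> \<and> \<epsilon> \<le> 1 \<longrightarrow>
    (\<exists>N::nat. N > 0 \<and>
      (let \<Omega> = mbsga_inputs P N (1/4);
           run = mbsga L \<sigma> (\<lambda>w \<xi>. grad (\<lambda>v. F v \<xi>) w) \<zeta> w1 N (1/4) (1/4)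
       in (\<integral>\<^sup>+\<omega>. edist 0 (limiting_subdiff h (iterate (run \<omega>))) \<partial>\<Omega>) \<le> ennreal \<epsilon> \<and>
          (\<forall>\<omega>\<in>space \<Omega>.
             real (gradient_calls (run \<omega>)) \<le> mbsga_const L l \<sigma> \<Delta> * \<epsilon> powr (-5) \<and>
             real (prox_calls (run \<omega>)) \<le> mbsga_const L l \<sigma> \<Delta> * \<epsilon> powr (-4))))"
proof (intro allI impI)
  fix \<epsilon> :: real
  assume \<epsilon>: "0 < \<epsilon> \<and> \<epsilon> \<le> 1"
  let ?G = "\<lambda>w \<xi>. grad (\<lambda>v. F v \<xi>) w"
  have L: "0 \<le> L" using f_smooth by (rule smooth_with_nonneg)
  have l: "0 \<le> l" using g_lipschitz by (rule lipschitz_on_nonneg)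
  have \<Delta>: "0 \<le> \<Delta>" using wstar_minimizer[of w1] by (simp add: Delta_eq)
  \<comment> \<open>The numerator in \<open>step_size_rate\<close> for
    \<open>A = \<Delta> + l^2\<close>. In \<open>C\<close> below, \<open>sqrt K\<close> accounts for
    the drift and \<open>2 * L * l\<close> for the move to the proximal point; the summand 1 ensures
    \<open>C \<ge> 1\<close>.\<close>
  define K where "K = (\<Delta> + l\<^sup>2) * (L + \<sigma> + 1) + \<sigma> * (L + 1)"
  define C where "C = 1 + 2 * L * l + sqrt K"
  define x where "x = C / \<epsilon>"
  \<comment> \<open>The least \<open>N\<close> whose fourth root is at least
    \<open>x\<close>.\<close>
  define N where "N = nat \<lceil>x ^ 4\<rceil>"
  have K: "0 < K"
    unfolding K_def using \<Delta> L sigma_pos by (intro add_nonneg_pos) auto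
  have C: "1 \<le> C" using L l K by (simp add: C_def)
  have x: "1 \<le> x" using C \<epsilon> by (simp add: x_def)
  have x4: "1 \<le> x ^ 4" using x by (rule one_le_power)
  have N: "x ^ 4 \<le> N" "N < x ^ 4 + 1" "N > 0"
    using x4 unfolding N_def by linarith+
  define r where "r = real N powr (1 / 4)"
  have r_pow: "r ^ 4 = N"
    using N(3) by (simp add: r_def powr_power)
  have r: "1 \<le> r" using N(3) by (simp add: r_def ge_one_powr_ge_zero)
  have r2: "sqrt N = r\<^sup>2"
    by (rule real_sqrt_unique) (simp_all flip: r_pow power_mult)
  have x_le_r: "x \<le> r"
    using N(1) r x unfolding r_pow[symmetric] by (subst (asm) power_mono_iff) auto
  define lam where "lam = prox_param N (1 / 4)"
  have lam: "lam = 1 / r"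
    by (simp add: lam_def prox_param_def r_def powr_minus_divide)
  define M where "M = batch_size N (1 / 4)"
  have M: "r \<le> M" "M > 0"
    using r unfolding M_def batch_size_def r_def[symmetric] by linarith+
  define \<gamma> where "\<gamma> = step_size L \<sigma> N (1 / 4)"
  have \<gamma>: "\<gamma> = min (1 / (L + r)) (1 / (\<sigma> * r\<^sup>2))"
    by (simp add: \<gamma>_def step_size_def r2 lam flip: lam_def)
  \<comment> \<open>Joint measurability of the oracle comes from
    \<open>borel_measurable_grad\<close>; the other locale assumptions are hypotheses.\<close>
  interpret P: prox_sgd P f g ?G "\<zeta> lam" L l \<sigma> lam
    using P_prob f_smooth g_lipschitz grad_F_integrable grad_F_unbiased grad_F_variance
      zeta_prox zeta_measurable r F_differentiable F_integrable
    by (auto simp: prox_sgd_def prox_sgd_axioms_def lam intro!: borel_measurable_grad)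
  define m where "m = h wstar - l\<^sup>2 * lam / 2"
  have m: "m \<le> P.envelope w" for w
    using P.envelope_ge[of w] wstar_minimizer[of w] by (simp add: m_def h_eq)
  have \<gamma>_pos: "0 < \<gamma>" using L r sigma_pos by (simp add: \<gamma>)
  have \<gamma>_L: "\<gamma> * (L + 1 / lam) \<le> 1"
  proof -
    have "\<gamma> * (L + r) \<le> 1 / (L + r) * (L + r)"
      using L r by (intro mult_right_mono) (auto simp: \<gamma>)
    then show ?thesis using L r by (simp add: lam)
  qed
  define s where "s = sqrt K / r"
  have s: "0 < s" "s\<^sup>2 = K / r\<^sup>2" using K r by (auto simp: s_def power_divide)
  have "2 * (P.envelope w1 - m) / (N * \<gamma>) + (L + 1 / lam) * \<gamma> * \<sigma>\<^sup>2 / M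
      \<le> (\<Delta> + l\<^sup>2) / (r ^ 4 * \<gamma>) + (L + r) * \<gamma> * \<sigma>\<^sup>2 / M"
  proof -
    \<comment> \<open>Since \<open>lam \<le> 1\<close>, the gap between potential and
      \<open>m\<close> at \<open>w1\<close> has a bound free of \<open>N\<close>.\<close>
    have "l\<^sup>2 * lam \<le> l\<^sup>2 * 1" using r by (intro mult_left_mono) (auto simp: lam)
    then have "2 * (P.envelope w1 - m) \<le> \<Delta> + l\<^sup>2"
      using P.envelope_le[of w1] by (simp add: m_def Delta_eq h_eq)
    then have "2 * (P.envelope w1 - m) / (N * \<gamma>) \<le> (\<Delta> + l\<^sup>2) / (N * \<gamma>)"
      using \<gamma>_pos by (intro divide_right_mono) auto
    then show ?thesis by (simp add: r_pow lam)
  qed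
  also have "\<dots> \<le> s\<^sup>2"
    unfolding s(2) K_def using r M L sigma_pos \<Delta> \<gamma> by (intro step_size_rate) auto
  finally have rate: "2 * (P.envelope w1 - m) / (N * \<gamma>) + (L + 1 / lam) * \<gamma> * \<sigma>\<^sup>2 / M \<le> s\<^sup>2" .
  define \<Omega> where "\<Omega> = mbsga_inputs P N (1 / 4)"
  define run where "run = mbsga L \<sigma> ?G \<zeta> w1 N (1 / 4) (1 / 4)"
  have run: "iterate (run \<omega>) = \<zeta> lam (P.iterate_at M \<gamma> w1 (fst \<omega> - 1) (snd \<omega>))"
    "gradient_calls (run \<omega>) = (fst \<omega> - 1) * M" "prox_calls (run \<omega>) = fst \<omega> - 1 + 1" for \<omega>
    by (simp_all add: run_def mbsga_def split_beta Let_def lam_def M_def \<gamma>_def mbsga_loop_calls)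
  have "(\<integral>\<^sup>+\<omega>. edist 0 (limiting_subdiff h (iterate (run \<omega>))) \<partial>\<Omega>) \<le> ennreal (s + 2 * L * l * lam)"
    unfolding run(1) \<Omega>_def mbsga_inputs_def M_def[symmetric] h_eq
    by (rule P.mean_edist_le[OF N(3) M(2) \<gamma>_pos \<gamma>_L m s(1) rate])
  also have "\<dots> \<le> ennreal \<epsilon>"
  proof (rule ennreal_leI)
    have "s + 2 * L * l * lam = (C - 1) / r"
      by (simp add: s_def lam C_def add_divide_distrib)
    also have "\<dots> \<le> C / x" using C x x_le_r by (intro frac_le) auto
    also have "\<dots> = \<epsilon>" using C \<epsilon> by (simp add: x_def)
    finally show "s + 2 * L * l * lam \<le> \<epsilon>" .
  qed
  finally have stationary: "(\<integral>\<^sup>+\<omega>. edist 0 (limiting_subdiff h (iterate (run \<omega>))) \<partial>\<Omega>) \<le> ennreal \<epsilon>" .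
  have "real (gradient_calls (run \<omega>)) \<le> mbsga_const L l \<sigma> \<Delta> * \<epsilon> powr (-5)
      \<and> real (prox_calls (run \<omega>)) \<le> mbsga_const L l \<sigma> \<Delta> * \<epsilon> powr (-4)"
    if "\<omega> \<in> space \<Omega>" for \<omega>
  proof -
    have const: "mbsga_const L l \<sigma> \<Delta> = 2 * C ^ 5"
      by (simp add: mbsga_const_def C_def K_def)
    have powers: "\<epsilon> powr (-5) = 1 / \<epsilon> ^ 5" "\<epsilon> powr (-4) = 1 / \<epsilon> ^ 4"
      using \<epsilon> by (simp_all add: powr_minus_divide)
    have R: "1 \<le> fst \<omega>" "fst \<omega> \<le> N"
      using that by (auto simp: \<Omega>_def mbsga_inputs_def space_pair_measure space_uniform_count_measure)
    \<comment> \<open>Rounding \<open>N\<close> up costs nothing, because only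
      \<open>R - 1 \<le> N - 1\<close> iterations are made.\<close>
    have R_le: "real (fst \<omega> - 1) \<le> x ^ 4"
      using R N(2) by linarith
    \<comment> \<open>The two roundings do not add up: the fourth power of the ceiling of
      \<open>x\<close> is an integer above \<open>x^4\<close>, hence at least \<open>N\<close>. So
      \<open>r\<close>, and with it its ceiling \<open>M\<close>, is at most the ceiling of
      \<open>x\<close>, which is below \<open>x + 1\<close>.\<close>
    have "real M \<le> 2 * x"
    proof -
      have "real N \<le> (of_int \<lceil>x\<rceil>) ^ 4"
      proof -
        have "x ^ 4 \<le> of_int \<lceil>x\<rceil> ^ 4" using x by (intro power_mono) auto
        then have "\<lceil>x ^ 4\<rceil> \<le> \<lceil>x\<rceil> ^ 4" by (simp add: ceiling_le_iff)
        moreover have "0 \<le> \<lceil>x ^ 4\<rceil>" using x4 by linarith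
        ultimately show ?thesis unfolding N_def by (simp flip: of_int_power)
      qed
      then have "r \<le> of_int \<lceil>x\<rceil>"
        using r x unfolding r_pow[symmetric] by (subst (asm) power_mono_iff) auto
      then have "\<lceil>r\<rceil> \<le> \<lceil>x\<rceil>" by (simp add: ceiling_le_iff)
      then show ?thesis
        using x unfolding M_def batch_size_def r_def[symmetric] by linarith
    qed
    then have "real (fst \<omega> - 1) * real M \<le> x ^ 4 * (2 * x)"
      using R_le x by (intro mult_mono) auto
    also have "\<dots> = 2 * x ^ 5" by (simp add: power_numeral_reduce)
    also have "\<dots> = 2 * C ^ 5 * (1 / \<epsilon> ^ 5)" by (simp add: x_def power_divide)
    finally have "real (gradient_calls (run \<omega>)) \<le> mbsga_const L l \<sigma> \<Delta> * \<epsilon> powr (-5)"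
      by (simp add: run const powers)
    \<comment> \<open>The additional proximal operation is the one that computes the output; it is
      absorbed by \<open>1 \<le> x^4\<close>.\<close>
    moreover have "real (fst \<omega> - 1 + 1) \<le> 2 * x ^ 4"
      using R_le x4 by simp
    then have "real (prox_calls (run \<omega>)) \<le> 2 * C ^ 4 * (1 / \<epsilon> ^ 4)"
      by (simp add: run x_def power_divide)
    \<comment> \<open>As \<open>C \<ge> 1\<close>, the constant for the gradient calls serves here
      too.\<close>
    moreover have "2 * C ^ 4 * (1 / \<epsilon> ^ 4) \<le> 2 * C ^ 5 * (1 / \<epsilon> ^ 4)"
      using C \<epsilon> by (intro mult_right_mono mult_left_mono power_increasing) auto
    ultimately show ?thesis by (simp add: const powers)
  qed
  with N(3) stationary show "\<exists>N::nat. N > 0 \<and>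
      (let \<Omega> = mbsga_inputs P N (1/4);
           run = mbsga L \<sigma> (\<lambda>w \<xi>. grad (\<lambda>v. F v \<xi>) w) \<zeta> w1 N (1/4) (1/4)
       in (\<integral>\<^sup>+\<omega>. edist 0 (limiting_subdiff h (iterate (run \<omega>))) \<partial>\<Omega>) \<le> ennreal \<epsilon> \<and>
          (\<forall>\<omega>\<in>space \<Omega>.
             real (gradient_calls (run \<omega>)) \<le> mbsga_const L l \<sigma> \<Delta> * \<epsilon> powr (-5) \<and>
             real (prox_calls (run \<omega>)) \<le> mbsga_const L l \<sigma> \<Delta> * \<epsilon> powr (-4)))"
    unfolding \<Omega>_def run_def Let_def by blast
qed

end
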